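(* For all integers $d\ge 1$ and $s\ge 0$, $$\left\langle {d \atop s}\right\rangle=\nabla^{d+1}(s+1)^d=(s+1)^d-\binom{d+1}{1}s^d+\binom{d+1}{2}(s-1)^d-\cdots ,$$ that is, $$\left\langle {d \atop s}\right\rangle=\sum_{h=0}^{\min(s,\,d+1)}(-1)^h\binom{d+1}{h}(s+1-h)^d .$$
   Context: Eulerian numbers: for integers $d\ge 1$, $\left\langle {d \atop s}\right\rangle$ is defined by $\left\langle {1 \atop 0}\right\rangle=1$, $\left\langle {d \atop k}\right\rangle=0$ for $k\ge d$ or $k<0$, and $\left\langle {d \atop s}\right\rangle=(1+s)\left\langle {d-1 \atop s}\right\rangle+(d-s)\left\langle {d-1 \atop s-1}\right\rangle$ for $d\ge 2$, $0\le s\le d-1$. $\nabla f(x)=f(x)-f(x-1)$ and $\nabla^h f(x)=f(x)-\binom h1 f(x-1)+\binom h2 f(x-2)-\cdots$. Here $\nabla^{d+1}$ is applied to the function $f(x)=x^d$ for $x>0$, $f(x)=0$ for $x\le 0$ (terms with nonpositive argument are replaced by $0$). *)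

theory Defs
  imports Complex_Main
begin

(* The row d = 0 is not part of the mathematical definition and is filled with 0. *)
fun eulerian :: "nat \<Rightarrow> int \<Rightarrow> int" where
  "eulerian 0 s = 0"
| "eulerian (Suc 0) s = (if s = 0 then 1 else 0)"
| "eulerian (Suc (Suc n)) s =
    (if s < 0 \<or> int (Suc (Suc n)) \<le> s then 0
     else (1 + s) * eulerian (Suc n) s
          + (int (Suc (Suc n)) - s) * eulerian (Suc n) (s - 1))"

definition nabla :: "(int \<Rightarrow> int) \<Rightarrow> int \<Rightarrow> int" where
  "nabla f x = f x - f (x - 1)"

definition pos_power :: "nat \<Rightarrow> int \<Rightarrow> int" where
  "pos_power d x = (if 0 < x then x ^ d else 0)"

lemma eulerian_out_of_range:
  assumes "1 \<le> d" and "k < 0 \<or> int d \<le> k"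
  shows "eulerian d k = 0"
  using assms by (cases "(d, k)" rule: eulerian.cases) auto

lemma eulerian_rec:
  assumes "2 \<le> d" and "0 \<le> s" and "s \<le> int d - 1"
  shows "eulerian d s = (1 + s) * eulerian (d - 1) s + (int d - s) * eulerian (d - 1) (s - 1)"
proof -
  obtain n where "d = Suc (Suc n)"
    using assms(1) by (metis Suc_le_D numeral_2_eq_2 Suc_le_mono)
  with assms show ?thesis by simp
qed

lemma nabla_funpow_expand:
  "(nabla ^^ h) f x = (\<Sum>k\<le>h. (-1) ^ k * int (h choose k) * f (x - int k))"
proof (induction h arbitrary: x)
  case 0
  then show ?case by simp
next
  case (Suc h)
  let ?t = "\<lambda>k. (-1) ^ k * int (h choose k) * f (x - int k)"
  let ?u = "\<lambda>k. (-1) ^ k * int (h choose k) * f (x - 1 - int k)"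
  have "(\<Sum>k\<le>Suc h. (-1) ^ k * int (Suc h choose k) * f (x - int k))
      = f x + (\<Sum>k\<le>h. (-1) ^ Suc k * int (Suc h choose Suc k) * f (x - int (Suc k)))"
    by (subst sum.atMost_Suc_shift) simp
  also have "\<dots> = f x + (\<Sum>k\<le>h. ?t (Suc k) - ?u k)"
    by (intro arg_cong2[where f = "(+)"] sum.cong refl) (simp add: algebra_simps)
  also have "\<dots> = (f x + (\<Sum>k\<le>h. ?t (Suc k))) - (\<Sum>k\<le>h. ?u k)"
    by (simp add: sum_subtractf)
  also have "f x + (\<Sum>k\<le>h. ?t (Suc k)) = (\<Sum>k\<le>Suc h. ?t k)"
    by (subst sum.atMost_Suc_shift) simp
  also have "\<dots> = (\<Sum>k\<le>h. ?t k)"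
    by simp
  also have "(\<Sum>k\<le>h. ?t k) - (\<Sum>k\<le>h. ?u k) = (nabla ^^ Suc h) f x"
    by (simp only: funpow.simps o_apply nabla_def [of "(nabla ^^ h) f"] Suc.IH)
  finally show ?case ..
qed

end

theory Submission
  imports Defs
begin

text \<open>
  Let \<open>F\<^sub>d = \<nabla>\<^bsup>d+1\<^esup> (pos_power d)\<close>. The truncated power satisfies
  \<open>pos_power (d+1) x = x * pos_power d x\<close> on all integers, and multiplication by \<open>x\<close> obeys a
  Leibniz rule with only two terms, since \<open>\<nabla>\<close> of the identity is \<open>1\<close> and \<open>\<nabla>\<^sup>2\<close> kills it
  (lemma \<open>nabla_funpow_mult_id\<close>). With \<open>n = d + 2\<close> and \<open>\<nabla>\<^bsup>d+2\<^esup> (pos_power d) = \<nabla> F\<^sub>d\<close> this gives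
  \<open>F\<^bsub>d+1\<^esub> x = x * (F\<^sub>d x - F\<^sub>d (x - 1)) + (d + 2) * F\<^sub>d (x - 1)
     = x * F\<^sub>d x + (d + 2 - x) * F\<^sub>d (x - 1)\<close>,
  which at \<open>x = s + 1\<close> is the recurrence of the Eulerian numbers. Induction on \<open>d\<close> then proves the
  first equation, and the second one is its binomial expansion, where the terms with nonpositive
  argument disappear.
\<close>

lemma nabla_funpow_mult_id:
  "(nabla ^^ n) (\<lambda>y. y * g y) x = x * (nabla ^^ n) g x + int n * (nabla ^^ (n - 1)) g (x - 1)"
proof (induction n arbitrary: x)
  case 0
  then show ?case by simp
next
  case (Suc n)
  have "(nabla ^^ Suc n) (\<lambda>y. y * g y) x
      = (x * (nabla ^^ n) g x + int n * (nabla ^^ (n - 1)) g (x - 1))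
        - ((x - 1) * (nabla ^^ n) g (x - 1) + int n * (nabla ^^ (n - 1)) g (x - 1 - 1))"
    by (simp add: nabla_def [of "(nabla ^^ n) h" for h] Suc.IH)
  also have "\<dots> = x * (nabla ^^ Suc n) g x + (nabla ^^ n) g (x - 1)
        + int n * nabla ((nabla ^^ (n - 1)) g) (x - 1)"
    by (simp add: nabla_def algebra_simps)
  \<comment> \<open>For \<open>n = 0\<close> the truncated exponent \<open>n - 1\<close> is wrong, but its coefficient vanishes.\<close>
  also have "int n * nabla ((nabla ^^ (n - 1)) g) (x - 1) = int n * (nabla ^^ n) g (x - 1)"
    by (cases n) auto
  finally show ?case
    by (simp add: algebra_simps)
qed

lemma pos_power_Suc: "pos_power (Suc d) = (\<lambda>x. x * pos_power d x)"
  by (auto simp: pos_power_def)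

lemma nabla_funpow_pos_power_Suc:
  "(nabla ^^ (Suc d + 1)) (pos_power (Suc d)) x
    = x * (nabla ^^ (d + 1)) (pos_power d) x
      + (int d + 2 - x) * (nabla ^^ (d + 1)) (pos_power d) (x - 1)"
proof -
  have "(nabla ^^ (Suc d + 1)) (pos_power (Suc d)) x
      = x * (nabla ^^ Suc (d + 1)) (pos_power d) x
        + (int d + 2) * (nabla ^^ (d + 1)) (pos_power d) (x - 1)"
    by (simp only: pos_power_Suc nabla_funpow_mult_id) simp
  also have "(nabla ^^ Suc (d + 1)) (pos_power d) x
      = (nabla ^^ (d + 1)) (pos_power d) x - (nabla ^^ (d + 1)) (pos_power d) (x - 1)"
    unfolding funpow.simps(2) o_apply by (rule nabla_def)
  finally show ?thesis
    by (simp add: algebra_simps)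
qed

text \<open>
  The recurrence holds outside \<open>0 \<le> s \<le> d\<close> as well, because row \<open>d\<close> is zero at both \<open>s\<close> and
  \<open>s - 1\<close> there. So the induction on the row can treat all integers \<open>s\<close> alike.
\<close>

lemma eulerian_Suc:
  assumes "1 \<le> d"
  shows "eulerian (Suc d) s = (1 + s) * eulerian d s + (int d + 1 - s) * eulerian d (s - 1)"
proof (cases "s < 0 \<or> int (Suc d) \<le> s")
  case True
  then have "eulerian d s = 0" "eulerian d (s - 1) = 0"
    using assms by (auto intro!: eulerian_out_of_range)
  moreover have "eulerian (Suc d) s = 0"
    using True by (intro eulerian_out_of_range) auto
  ultimately show ?thesis by simp
next
  case False
  then show ?thesis
    using assms eulerian_rec [of "Suc d" s] by (simp add: algebra_simps)
qed

lemma eulerian_eq_nabla_funpow: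
  assumes "1 \<le> d"
  shows "eulerian d s = (nabla ^^ (d + 1)) (pos_power d) (s + 1)"
  using assms
proof (induction d arbitrary: s rule: dec_induct)
  case base
  show ?case by (simp add: nabla_def pos_power_def)
next
  case (step d)
  have "eulerian (Suc d) s
      = (1 + s) * (nabla ^^ (d + 1)) (pos_power d) (s + 1)
        + (int d + 1 - s) * (nabla ^^ (d + 1)) (pos_power d) s"
    using step.hyps by (simp only: eulerian_Suc step.IH) simp
  also have "\<dots> = (nabla ^^ (Suc d + 1)) (pos_power (Suc d)) (s + 1)"
    unfolding nabla_funpow_pos_power_Suc by (simp add: algebra_simps)
  finally show ?case .
qed

theorem theorem3:
  fixes d s :: nat
  assumes "1 \<le> d"
  shows "eulerian d (int s) = (nabla ^^ (d + 1)) (pos_power d) (int s + 1) \<and>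
         eulerian d (int s) =
           (\<Sum>h = 0..min s (d + 1). (-1) ^ h * int ((d + 1) choose h) * (int s + 1 - int h) ^ d)"
proof
  show nabla: "eulerian d (int s) = (nabla ^^ (d + 1)) (pos_power d) (int s + 1)"
    using assms by (rule eulerian_eq_nabla_funpow)
  have "eulerian d (int s)
      = (\<Sum>h\<le>d + 1. (-1) ^ h * int ((d + 1) choose h) * pos_power d (int s + 1 - int h))"
    unfolding nabla nabla_funpow_expand ..
  also have "\<dots> = (\<Sum>h = 0..min s (d + 1).
      (-1) ^ h * int ((d + 1) choose h) * (int s + 1 - int h) ^ d)"
    by (rule sum.mono_neutral_cong_right) (auto simp: pos_power_def)
  finally show "eulerian d (int s) = (\<Sum>h = 0..min s (d + 1).
      (-1) ^ h * int ((d + 1) choose h) * (int s + 1 - int h) ^ d)" .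
qed

end
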